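(* Let $\varphi:S^1\to S^1$ be an orientation preserving homeomorphism with rotation number $\varrho(\varphi)=\frac{p}{q}$. For every $\varepsilon>0$ there exists $N=N(\varepsilon)$ such that for every point $z\in S^1$ at least one of the following two conditions is satisfied: (1) there exists a periodic point $z_0^+\in\mathrm{Per}(\varphi)$ such that $|\varphi^{nq+i}(z)-\varphi^i(z_0^+)|<\varepsilon$ for all $n\ge N$ and $i=0,1,\dots,q-1$; or (2) there exists a periodic point $z_0^-\in\mathrm{Per}(\varphi)$ such that $|\varphi^{-nq-i}(z)-\varphi^{-i}(z_0^-)|<\varepsilon$ for all $n\ge N$ and $i=0,1,\dots,q-1$.
   Context: $S^1$ is the unit circle and $|u-v|$ denotes the distance on $S^1$ (arc length). For a lift $\Phi:\mathbb{R}\to\mathbb{R}$ of $\varphi$ under $x\mapsto\exp(2\pi\mathrm{i}x)$, the rotation number is $\varrho(\varphi)=\lim_{n\to\infty}\Phi^n(x)/n\bmod 1$. $\mathrm{Per}(\varphi)$ is the set of periodic points of $\varphi$. *)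

theory Defs
  imports "HOL-Analysis.Analysis"
begin

abbreviation circle :: "complex set" where
  "circle \<equiv> sphere 0 1"

(* The principal argument of the quotient has values in (-pi, pi], so its absolute
   value is the length of the shorter arc (total circumference 2 * pi). *)
definition arc_dist :: "complex \<Rightarrow> complex \<Rightarrow> real" where
  "arc_dist u v = \<bar>Arg (u / v)\<bar>"

definition circle_lift :: "(complex \<Rightarrow> complex) \<Rightarrow> (real \<Rightarrow> real) \<Rightarrow> bool" where
  "circle_lift \<phi> \<Phi> \<longleftrightarrow> continuous_on UNIV \<Phi> \<and>
     (\<forall>x. \<phi> (exp (2 * of_real pi * \<i> * of_real x)) = exp (2 * of_real pi * \<i> * of_real (\<Phi> x)))"

definition orientation_preserving :: "(complex \<Rightarrow> complex) \<Rightarrow> bool" where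
  "orientation_preserving \<phi> \<longleftrightarrow> (\<exists>\<Phi>. circle_lift \<phi> \<Phi> \<and> strict_mono \<Phi>)"

(* The class modulo 1 is represented by its element of [0, 1).  For an orientation preserving
   homeomorphism the limit exists, and its class depends neither on the lift nor on x. *)
definition rotation_number :: "(complex \<Rightarrow> complex) \<Rightarrow> real" where
  "rotation_number \<phi> =
     (THE r. \<forall>\<Phi> x. circle_lift \<phi> \<Phi> \<longrightarrow>
        (\<exists>L. (\<lambda>n. (\<Phi> ^^ n) x / real n) \<longlonglongrightarrow> L \<and> r = frac L))"

definition Per :: "(complex \<Rightarrow> complex) \<Rightarrow> complex set" where
  "Per \<phi> = {z \<in> circle. \<exists>n>0. (\<phi> ^^ n) z = z}"

end

theory Submission
  imports Defs
begin

text \<open>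
  Everything is decided on the real line. A lift \<open>\<Phi>\<close> of \<open>\<phi>\<close> moves any two points by amounts that
  differ by at most \<open>1\<close>, so its displacement along \<open>n\<close> steps is \<open>n * L\<close> up to a bounded error
  (\<open>translation_number_exists\<close>), and \<open>L mod 1\<close> is the rotation number. If it is \<open>p / q\<close>, then
  \<open>q * L\<close> is an integer \<open>k\<close>, and \<open>\<Psi> = \<Phi>\<^sup>q - k\<close> is a lift of \<open>\<phi>\<^sup>q\<close> all of whose orbits are bounded.
  Since \<open>\<Psi>\<close> is increasing, each orbit is monotone and therefore converges to a fixed point of
  \<open>\<Psi>\<close>, which represents a periodic point of \<open>\<phi>\<close>.

  This convergence is not uniform, because points close to a repelling fixed point leave it
  slowly. What is uniform is the time after which an orbit has come \<open>\<delta>\<close>-close to some fixed point,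
  by compactness of \<open>[0, 1]\<close> and periodicity
  (\<open>orbits_reach_fixed_points_in_bounded_time\<close>). Let this happen for \<open>x\<close> at time \<open>j \<le> N\<close> near
  the fixed point \<open>y\<close>. If the orbit of \<open>x\<close> moves towards \<open>y\<close>, then it stays between \<open>\<Psi>\<^sup>j x\<close> and \<open>y\<close>
  from then on. If it moves away from \<open>y\<close>, then \<open>x\<close> and its entire backward orbit lie between
  \<open>y\<close> and \<open>\<Psi>\<^sup>j x\<close>. This is the alternative of the theorem
  (\<open>shadowing_of_orbit_near_fixed_point\<close>). The remaining iterates \<open>i < q\<close> cost only a choice of
  \<open>\<delta>\<close>, since finitely many iterates of \<open>\<phi>\<close> and of its inverse are uniformly continuous.
\<close>

section \<open>Lifts of degree one and the translation number\<close>

text \<open>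
  These are the increasing lifts of orientation preserving circle homeomorphisms; the class is
  closed under iteration and integer translation, so that \<open>\<Phi>\<^sup>q - k\<close> belongs to it.
\<close>
definition lift_map :: "(real \<Rightarrow> real) \<Rightarrow> bool" where
  "lift_map f \<longleftrightarrow> continuous_on UNIV f \<and> strict_mono f \<and> (\<forall>x. f (x + 1) = f x + 1)"

lemma lift_map_add_int:
  assumes "lift_map f"
  shows "f (x + of_int k) = f x + of_int k"
proof -
  have per: "f (y + 1) = f y + 1" for y
    using assms by (simp add: lift_map_def)
  have nat: "f (y + real n) = f y + real n" for y n
  proof (induction n)
    case (Suc n)
    then show ?case
      using per[of "y + real n"] by (simp add: add_ac)
  qed simp
  show ?thesis
  proof (cases "k \<ge> 0")
    case True
    then show ?thesis using nat[of x "nat k"] by simp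
  next
    case False
    then show ?thesis using nat[of "x + of_int k" "nat (- k)"] by simp
  qed
qed

lemma lift_map_funpow:
  assumes "lift_map f"
  shows "lift_map (f ^^ n)"
proof (induction n)
  case 0
  then show ?case by (simp add: lift_map_def strict_mono_def)
next
  case (Suc n)
  have "continuous_on UNIV (f \<circ> (f ^^ n))"
    using Suc assms unfolding lift_map_def
    by (intro continuous_on_compose) (auto intro: continuous_on_subset)
  with Suc assms show ?case
    by (simp add: lift_map_def strict_mono_def)
qed

lemma lift_map_minus_int:
  assumes "lift_map f"
  shows "lift_map (\<lambda>x. f x - of_int k)"
  using assms by (simp add: lift_map_def strict_mono_def continuous_on_diff)

lemma lift_map_less_iff: "lift_map f \<Longrightarrow> f x < f y \<longleftrightarrow> x < y"
  by (simp add: lift_map_def strict_mono_less)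

lemma lift_map_le_iff: "lift_map f \<Longrightarrow> f x \<le> f y \<longleftrightarrow> x \<le> y"
  by (simp add: lift_map_def strict_mono_less_eq)

lemma lift_map_isCont: "lift_map f \<Longrightarrow> isCont f x"
  by (simp add: lift_map_def continuous_on_eq_continuous_at)

text \<open>
  The displacement \<open>f x - x\<close> has period \<open>1\<close>, so \<open>u\<close> may be moved into \<open>[v, v + 1)\<close>. There the
  differences of arguments and of values both lie in \<open>[0, 1]\<close>.
\<close>
lemma displacement_oscillation:
  assumes f: "lift_map f"
  shows "\<bar>(f u - u) - (f v - v)\<bar> \<le> 1"
proof -
  define k where "k = \<lfloor>u - v\<rfloor>"
  define w where "w = u - of_int k"
  have w: "v \<le> w" "w < v + 1"
    unfolding w_def k_def by linarith+
  have "f v \<le> f w" "f w \<le> f v + 1"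
    using w lift_map_le_iff[OF f, of v w] lift_map_less_iff[OF f, of w "v + 1"]
      lift_map_add_int[OF f, of v 1] by auto
  moreover have "f u = f w + of_int k"
    using lift_map_add_int[OF f, of w k] by (simp add: w_def)
  ultimately show ?thesis
    using w unfolding w_def by linarith
qed

text \<open>
  Comparing both \<open>m * a n\<close> and \<open>n * a m\<close> with \<open>a (m * n)\<close> shows that every
  \<open>(a n - C) / n\<close> lies below every \<open>(a m + C) / m\<close>; any number separating the two families, such
  as the supremum of the first, is the slope.
\<close>
lemma almost_additive_sequence_is_almost_linear:
  fixes a :: "nat \<Rightarrow> real"
  assumes add: "\<And>m n. \<bar>a (m + n) - a m - a n\<bar> \<le> C" and zero: "a 0 = 0"
  shows "\<exists>L. \<forall>n. \<bar>a n - real n * L\<bar> \<le> C"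
proof -
  have C: "C \<ge> 0" using add[of 0 0] by linarith
  have mult: "\<bar>a (m * n) - real m * a n\<bar> \<le> real m * C" for m n
  proof (induction m)
    case 0
    then show ?case by (simp add: zero)
  next
    case (Suc m)
    then show ?case
      using add[of n "m * n"] by (simp add: algebra_simps abs_le_iff)
  qed
  have cross: "(a n - C) / real n \<le> (a m + C) / real m" if "n > 0" "m > 0" for m n
  proof -
    have "real m * (a n - C) \<le> real n * (a m + C)"
      using mult[of m n] mult[of n m] by (simp add: algebra_simps abs_le_iff)
    then show ?thesis using that by (simp add: field_simps)
  qed
  define L where "L = (SUP n\<in>{0<..}. (a n - C) / real n)"
  have bdd: "bdd_above ((\<lambda>n. (a n - C) / real n) ` {0<..})"
    using cross[of _ 1] by (auto simp: bdd_above_def)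
  have low: "(a n - C) / real n \<le> L" if "n > 0" for n
    unfolding L_def using that bdd by (intro cSUP_upper) auto
  have up: "L \<le> (a m + C) / real m" if "m > 0" for m
    unfolding L_def using that cross by (intro cSUP_least) auto
  have "\<bar>a n - real n * L\<bar> \<le> C" for n
  proof (cases "n = 0")
    case True
    then show ?thesis using C zero by simp
  next
    case False
    then show ?thesis
      using low[of n] up[of n] by (simp add: field_simps abs_le_iff)
  qed
  then show ?thesis by blast
qed

text \<open>
  The orbit of \<open>0\<close> is almost additive with constant \<open>1\<close>, and another orbit costs a second \<open>1\<close>.
  The bound does not depend on \<open>n\<close>; this is what later makes orbits bounded, which
  the existence of the limit alone would not give.
\<close>
lemma translation_number_exists:
  assumes f: "lift_map f"
  obtains L where "\<And>n x. \<bar>(f ^^ n) x - x - real n * L\<bar> \<le> 2"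
proof -
  have osc: "\<bar>((f ^^ n) u - u) - ((f ^^ n) v - v)\<bar> \<le> 1" for n u v
    by (rule displacement_oscillation[OF lift_map_funpow[OF f]])
  have "\<bar>(f ^^ (m + n)) 0 - (f ^^ m) 0 - (f ^^ n) 0\<bar> \<le> 1" for m n
    using osc[of m "(f ^^ n) 0" 0] by (simp add: funpow_add)
  then obtain L where L: "\<And>n. \<bar>(f ^^ n) 0 - real n * L\<bar> \<le> 1"
    using almost_additive_sequence_is_almost_linear[of "\<lambda>n. (f ^^ n) 0" 1] by auto
  have "\<bar>(f ^^ n) x - x - real n * L\<bar> \<le> 2" for n x
    using osc[of n x 0] L[of n] by linarith
  then show thesis by (rule that)
qed

lemma translation_number_limit:
  assumes "\<And>n. \<bar>(f ^^ n) x - x - real n * L\<bar> \<le> 2"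
  shows "(\<lambda>n. (f ^^ n) x / real n) \<longlonglongrightarrow> L"
proof -
  have "(\<lambda>n. (2 + \<bar>x\<bar>) / real n) \<longlonglongrightarrow> 0"
    by (rule lim_const_over_n)
  moreover have "\<forall>\<^sub>F n in sequentially. norm ((f ^^ n) x / real n - L) \<le> (2 + \<bar>x\<bar>) / real n"
  proof (rule eventually_sequentiallyI[of 1])
    fix n :: nat assume n: "1 \<le> n"
    then have "(f ^^ n) x / real n - L = ((f ^^ n) x - real n * L) / real n"
      by (simp add: field_simps)
    moreover have "\<bar>(f ^^ n) x - real n * L\<bar> \<le> 2 + \<bar>x\<bar>"
      using assms[of n] by linarith
    ultimately show "norm ((f ^^ n) x / real n - L) \<le> (2 + \<bar>x\<bar>) / real n"
      using n by (simp add: divide_right_mono)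
  qed
  ultimately have "(\<lambda>n. (f ^^ n) x / real n - L) \<longlonglongrightarrow> 0"
    by (rule Lim_null_comparison[rotated])
  then show ?thesis by (rule LIM_zero_cancel)
qed

section \<open>Lifts of circle maps and the rotation number\<close>

definition circle_point :: "real \<Rightarrow> complex" where
  "circle_point x = exp (2 * of_real pi * \<i> * of_real x)"

lemma circle_lift_iff:
  "circle_lift \<phi> \<Phi> \<longleftrightarrow>
     continuous_on UNIV \<Phi> \<and> (\<forall>x. \<phi> (circle_point x) = circle_point (\<Phi> x))"
  by (simp add: circle_lift_def circle_point_def)

lemma circle_point_eq_cis: "circle_point x = cis (2 * pi * x)"
  by (simp add: circle_point_def cis_conv_exp mult_ac)

lemma circle_point_in_circle: "circle_point x \<in> circle"
  by (simp add: circle_point_eq_cis)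

lemma circle_point_eq_iff: "circle_point x = circle_point y \<longleftrightarrow> (\<exists>k::int. x = y + of_int k)"
proof -
  have "circle_point x = circle_point y \<longleftrightarrow>
      (\<exists>k::int. 2 * pi * x = 2 * pi * y + 2 * pi * of_int k)"
    unfolding circle_point_eq_cis cis.ctr complex.inject
    using sin_cos_eq_iff[of "2 * pi * x" "2 * pi * y"] by auto
  also have "(\<lambda>k::int. 2 * pi * x = 2 * pi * y + 2 * pi * of_int k) = (\<lambda>k. x = y + of_int k)"
    by (simp flip: distrib_left)
  finally show ?thesis .
qed

lemma circle_point_surj:
  assumes "z \<in> circle"
  obtains x where "z = circle_point x"
proof -
  obtain t where "z = Complex (cos t) (sin t)"
    using assms by (auto intro: complex_unimodular_polar[of z])
  then have "z = circle_point (t / (2 * pi))"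
    by (simp add: circle_point_eq_cis cis.ctr)
  then show thesis by (rule that)
qed

text \<open>
  A lift changes by an integer over one period. If the integer were at least \<open>2\<close>, the
  intermediate value theorem would give two points of one period with the same image on the circle.
\<close>
lemma lift_map_if_strict_mono_circle_lift:
  assumes lift: "circle_lift \<phi> \<Phi>" and mono: "strict_mono \<Phi>" and inj: "inj_on \<phi> circle"
  shows "lift_map \<Phi>"
proof -
  have cont: "continuous_on UNIV \<Phi>"
    and comm: "\<And>x. \<phi> (circle_point x) = circle_point (\<Phi> x)"
    using lift by (auto simp: circle_lift_iff)
  have "\<Phi> (x + 1) = \<Phi> x + 1" for x
  proof -
    have "circle_point (x + 1) = circle_point x"
      unfolding circle_point_eq_iff by (rule exI[of _ 1]) simp
    then have "circle_point (\<Phi> (x + 1)) = circle_point (\<Phi> x)"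
      by (metis comm)
    then obtain k :: int where k: "\<Phi> (x + 1) = \<Phi> x + of_int k"
      unfolding circle_point_eq_iff by blast
    have "\<Phi> x < \<Phi> (x + 1)" using mono by (simp add: strict_mono_def)
    then have "k \<ge> 1" using k by simp
    moreover have "\<not> k \<ge> 2"
    proof
      assume "k \<ge> 2"
      then have "real_of_int k \<ge> 2" by simp
      then have "\<Phi> x \<le> \<Phi> x + 1" "\<Phi> x + 1 \<le> \<Phi> (x + 1)" using k by simp_all
      then obtain y where y: "x \<le> y" "y \<le> x + 1" "\<Phi> y = \<Phi> x + 1"
        using IVT'[of \<Phi> x "\<Phi> x + 1" "x + 1"] continuous_on_subset[OF cont] by auto
      have "circle_point (\<Phi> y) = circle_point (\<Phi> x)"
        unfolding circle_point_eq_iff by (rule exI[of _ 1]) (simp add: y)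
      then have "\<phi> (circle_point y) = \<phi> (circle_point x)" by (simp add: comm)
      then have "circle_point y = circle_point x"
        using inj circle_point_in_circle by (meson inj_onD)
      then obtain j :: int where j: "y = x + of_int j"
        unfolding circle_point_eq_iff by blast
      with y have "j = 0 \<or> j = 1" by auto
      then show False
        using j y k \<open>real_of_int k \<ge> 2\<close> by auto
    qed
    ultimately have "k = 1" by simp
    then show ?thesis using k by simp
  qed
  then show ?thesis using cont mono by (simp add: lift_map_def)
qed

text \<open>
  The difference of two lifts is continuous and integer valued, and distinct integers are at
  distance at least \<open>1\<close>.
\<close>
lemma circle_lifts_differ_by_int:
  assumes "circle_lift \<phi> \<Phi>" "circle_lift \<phi> \<Psi>"
  obtains k :: int where "\<And>x. \<Psi> x = \<Phi> x + of_int k"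
proof -
  have int: "\<exists>k::int. \<Psi> x = \<Phi> x + of_int k" for x
    using assms unfolding circle_lift_iff by (metis circle_point_eq_iff)
  have "(\<lambda>x. \<Psi> x - \<Phi> x) constant_on UNIV"
  proof (rule continuous_discrete_range_constant)
    show "continuous_on UNIV (\<lambda>x. \<Psi> x - \<Phi> x)"
      using assms by (simp add: circle_lift_iff continuous_on_diff)
    fix x
    have "1 \<le> norm ((\<Psi> y - \<Phi> y) - (\<Psi> x - \<Phi> x))" if ne: "\<Psi> y - \<Phi> y \<noteq> \<Psi> x - \<Phi> x" for y
    proof -
      obtain k l :: int where "\<Psi> x = \<Phi> x + of_int k" "\<Psi> y = \<Phi> y + of_int l"
        using int by meson
      then have "(\<Psi> y - \<Phi> y) - (\<Psi> x - \<Phi> x) = of_int (l - k)" "l \<noteq> k"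
        using ne by auto
      then show ?thesis by (simp only: norm_of_int)
    qed
    then show "\<exists>e>0. \<forall>y. y \<in> UNIV \<and> \<Psi> y - \<Phi> y \<noteq> \<Psi> x - \<Phi> x \<longrightarrow>
        e \<le> norm ((\<Psi> y - \<Phi> y) - (\<Psi> x - \<Phi> x))"
      by (intro exI[of _ 1]) auto
  qed simp
  then obtain c where c: "\<And>x. \<Psi> x - \<Phi> x = c"
    unfolding constant_on_def by auto
  obtain k :: int where "\<Psi> 0 = \<Phi> 0 + of_int k" using int by blast
  then have "c = of_int k" using c[of 0] by simp
  then have "\<Psi> x = \<Phi> x + of_int k" for x using c[of x] by simp
  then show thesis by (rule that)
qed

text \<open>
  The definite description in the definition of the rotation number speaks about all continuous
  lifts. They are integer translates of \<open>\<Phi>\<close>, which shifts the limit by an integer and leaves its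
  fractional part unchanged.
\<close>
lemma rotation_number_eq_frac_translation_number:
  assumes lift: "circle_lift \<phi> \<Phi>" and map: "lift_map \<Phi>"
    and L: "\<And>n x. \<bar>(\<Phi> ^^ n) x - x - real n * L\<bar> \<le> 2"
  shows "rotation_number \<phi> = frac L"
  unfolding rotation_number_def
proof (rule the_equality)
  show "\<forall>\<Psi> x. circle_lift \<phi> \<Psi> \<longrightarrow>
      (\<exists>M. (\<lambda>n. (\<Psi> ^^ n) x / real n) \<longlonglongrightarrow> M \<and> frac L = frac M)"
  proof (intro allI impI)
    fix \<Psi> x assume "circle_lift \<phi> \<Psi>"
    then obtain k :: int where k: "\<And>x. \<Psi> x = \<Phi> x + of_int k"
      using circle_lifts_differ_by_int[OF lift] by blast
    have iter: "(\<Psi> ^^ n) x = (\<Phi> ^^ n) x + real n * of_int k" for n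
    proof (induction n)
      case (Suc n)
      have "(\<Psi> ^^ Suc n) x = \<Phi> ((\<Phi> ^^ n) x + of_int (int n * k)) + of_int k"
        using Suc k[of "(\<Psi> ^^ n) x"] by simp
      also have "\<dots> = (\<Phi> ^^ Suc n) x + of_int (int n * k) + of_int k"
        by (subst lift_map_add_int[OF map]) simp
      finally show ?case by (simp add: algebra_simps)
    qed simp
    have "\<bar>(\<Psi> ^^ n) x - x - real n * (L + of_int k)\<bar> \<le> 2" for n
      using L[of n x] by (simp add: iter algebra_simps)
    then have "(\<lambda>n. (\<Psi> ^^ n) x / real n) \<longlonglongrightarrow> L + of_int k"
      by (rule translation_number_limit)
    then show "\<exists>M. (\<lambda>n. (\<Psi> ^^ n) x / real n) \<longlonglongrightarrow> M \<and> frac L = frac M"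
      by (intro exI[of _ "L + of_int k"]) simp
  qed
next
  fix r
  assume "\<forall>\<Psi> x. circle_lift \<phi> \<Psi> \<longrightarrow>
      (\<exists>M. (\<lambda>n. (\<Psi> ^^ n) x / real n) \<longlonglongrightarrow> M \<and> r = frac M)"
  then obtain M where "(\<lambda>n. (\<Phi> ^^ n) 0 / real n) \<longlonglongrightarrow> M" "r = frac M"
    using lift by blast
  moreover have "(\<lambda>n. (\<Phi> ^^ n) 0 / real n) \<longlonglongrightarrow> L"
    by (rule translation_number_limit) (rule L)
  ultimately show "r = frac L" using LIMSEQ_unique by blast
qed

section \<open>Orbits near the fixed points of a lift\<close>

lemma bounded_orbit_tendsto_fixed_point:
  assumes f: "lift_map f" and bdd: "\<And>n. \<bar>(f ^^ n) x - x\<bar> \<le> C"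
  obtains y where "f y = y" "(\<lambda>n. (f ^^ n) x) \<longlonglongrightarrow> y"
proof -
  \<comment> \<open>The order of \<open>x\<close> and \<open>f x\<close> is inherited by all consecutive iterates.\<close>
  have "monoseq (\<lambda>n. (f ^^ n) x)"
  proof (cases "x \<le> f x")
    case True
    then have "(f ^^ n) x \<le> (f ^^ n) (f x)" for n
      by (simp add: lift_map_le_iff[OF lift_map_funpow[OF f]])
    then show ?thesis by (intro monoI2 disjI1 mono_SucI1) (auto simp: funpow_swap1)
  next
    case False
    then have "(f ^^ n) (f x) \<le> (f ^^ n) x" for n
      by (simp add: lift_map_le_iff[OF lift_map_funpow[OF f]])
    then show ?thesis by (intro mono_SucI2) (auto simp: funpow_swap1)
  qed
  moreover have "Bseq (\<lambda>n. (f ^^ n) x)"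
  proof (rule BseqI')
    show "norm ((f ^^ n) x) \<le> C + \<bar>x\<bar>" for n
      using bdd[of n] by simp
  qed
  ultimately have "convergent (\<lambda>n. (f ^^ n) x)"
    by (simp add: Bseq_monoseq_convergent)
  then obtain y where y: "(\<lambda>n. (f ^^ n) x) \<longlonglongrightarrow> y"
    by (auto simp: convergent_def)
  have "(\<lambda>n. f ((f ^^ n) x)) \<longlonglongrightarrow> f y"
    by (rule isCont_tendsto_compose[OF lift_map_isCont[OF f] y])
  moreover have "(\<lambda>n. f ((f ^^ n) x)) \<longlonglongrightarrow> y"
    using LIMSEQ_Suc[OF y] by simp
  ultimately have "f y = y" using LIMSEQ_unique by blast
  then show thesis using y by (rule that)
qed

text \<open>
  Coming \<open>\<delta>\<close>-close to a fixed point at a given time \<open>j\<close> is an open condition on the starting point,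
  and every starting point satisfies it for some \<open>j\<close>, so finitely many times suffice on \<open>[0, 1]\<close>.
  Integer translations commute with \<open>f\<close> and preserve its fixed points.
\<close>
lemma orbits_reach_fixed_points_in_bounded_time:
  assumes f: "lift_map f" and bdd: "\<And>n x. \<bar>(f ^^ n) x - x\<bar> \<le> C" and "\<delta> > 0"
  obtains N where "\<And>x. \<exists>j\<le>N. \<exists>y. f y = y \<and> \<bar>(f ^^ j) x - y\<bar> < \<delta>"
proof -
  define U where "U j = (f ^^ j) -` (\<Union>y\<in>{y. f y = y}. ball y \<delta>)" for j :: nat
  have mem: "x \<in> U j \<longleftrightarrow> (\<exists>y. f y = y \<and> \<bar>(f ^^ j) x - y\<bar> < \<delta>)" for x j
    by (auto simp: U_def dist_real_def abs_minus_commute)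
  have "open (U j)" for j
    unfolding U_def using lift_map_funpow[OF f, of j]
    by (intro open_vimage) (auto simp: lift_map_def)
  moreover have "x \<in> (\<Union>j. U j)" for x
  proof -
    obtain y where y: "f y = y" "(\<lambda>n. (f ^^ n) x) \<longlonglongrightarrow> y"
      using bounded_orbit_tendsto_fixed_point[OF f bdd] by blast
    then obtain j where "norm ((f ^^ j) x - y) < \<delta>"
      using LIMSEQ_D[OF y(2) \<open>\<delta> > 0\<close>] by blast
    then show ?thesis using y mem by auto
  qed
  ultimately obtain J where J: "finite J" "{0..1} \<subseteq> (\<Union>j\<in>J. U j)"
    using compactE_image[of "{0..1::real}" UNIV U] by (metis compact_Icc subsetI)
  have "\<exists>j\<le>Max J. \<exists>y. f y = y \<and> \<bar>(f ^^ j) x - y\<bar> < \<delta>" for x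
  proof -
    have "frac x \<in> {0..1}" using frac_lt_1[of x] by auto
    then obtain j where j: "j \<in> J" "frac x \<in> U j" using J by blast
    then obtain y where y: "f y = y" "\<bar>(f ^^ j) (frac x) - y\<bar> < \<delta>"
      by (auto simp: mem)
    have "(f ^^ j) x = (f ^^ j) (frac x) + of_int \<lfloor>x\<rfloor>"
      using lift_map_add_int[OF lift_map_funpow[OF f], of j "frac x" "\<lfloor>x\<rfloor>"]
      by (simp add: frac_def)
    moreover have "f (y + of_int \<lfloor>x\<rfloor>) = y + of_int \<lfloor>x\<rfloor>"
      using lift_map_add_int[OF f] y by simp
    ultimately have "f (y + of_int \<lfloor>x\<rfloor>) = y + of_int \<lfloor>x\<rfloor> \<and>
        \<bar>(f ^^ j) x - (y + of_int \<lfloor>x\<rfloor>)\<bar> < \<delta>"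
      using y(2) by simp
    moreover have "j \<le> Max J" using J(1) j(1) by (rule Max_ge)
    ultimately show ?thesis by blast
  qed
  then show thesis by (rule that)
qed

lemma fixed_point_funpow: "f y = y \<Longrightarrow> (f ^^ n) y = y"
  by (induction n) auto

text \<open>
  An increasing map never carries an orbit across a fixed point, and the direction of motion is
  constant along an orbit, backwards as well as forwards. Hence the orbit lies on one side of \<open>y\<close>
  and either approaches \<open>y\<close>, so that times after \<open>j\<close> are at least as close as time \<open>j\<close>, or recedes
  from \<open>y\<close>, so that times before \<open>j\<close> are. Backward orbits are described by preimages, which
  avoids an inverse of \<open>f\<close>.
\<close>
lemma shadowing_of_orbit_near_fixed_point:
  assumes f: "lift_map f" and y: "f y = y" and near: "\<bar>(f ^^ j) x - y\<bar> < \<delta>"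
  shows "(\<forall>n\<ge>j. \<bar>(f ^^ n) x - y\<bar> < \<delta>) \<or> (\<forall>n w. (f ^^ n) w = x \<longrightarrow> \<bar>w - y\<bar> < \<delta>)"
proof -
  note le = lift_map_le_iff[OF lift_map_funpow[OF f]]
  \<comment> \<open>An orbit stays on its side of \<open>y\<close>.\<close>
  have fix_le: "(f ^^ n) u \<le> y \<longleftrightarrow> u \<le> y" "y \<le> (f ^^ n) u \<longleftrightarrow> y \<le> u" for n u
    using le[of n u y] le[of n y u] fixed_point_funpow[of f y n] y by simp_all
  have step: "(f ^^ n) (f u) = f ((f ^^ n) u)" for n u
    by (simp add: funpow_swap1)
  have up: "u \<le> (f ^^ n) u" if "u \<le> f u" for n u
  proof (induction n)
    case (Suc n)
    have "(f ^^ n) u \<le> (f ^^ n) (f u)" using that by (simp add: le)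
    with Suc show ?case by (simp add: step)
  qed simp
  have down: "(f ^^ n) u \<le> u" if "f u \<le> u" for n u
  proof (induction n)
    case (Suc n)
    have "(f ^^ n) (f u) \<le> (f ^^ n) u" using that by (simp add: le)
    with Suc show ?case by (simp add: step)
  qed simp
  \<comment> \<open>All points of an orbit move in the same direction. For \<open>u\<close> a preimage of \<open>x\<close> the
    direction at \<open>x\<close> decides the one at \<open>u\<close>.\<close>
  have dir: "(f ^^ n) u \<le> f ((f ^^ n) u) \<longleftrightarrow> u \<le> f u"
    "f ((f ^^ n) u) \<le> (f ^^ n) u \<longleftrightarrow> f u \<le> u" for n u
    using le[of n u "f u"] le[of n "f u" u] by (simp_all add: step)
  have split: "(f ^^ n) x = (f ^^ (n - j)) ((f ^^ j) x)" if "j \<le> n" for n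
    using that funpow_add[of "n - j" j f] by (metis comp_apply le_add_diff_inverse2)
  show ?thesis
  proof (cases "x \<le> f x")
    case xup: True
    show ?thesis
    proof (cases "x \<le> y")
      case True
      have between: "(f ^^ j) x \<le> (f ^^ n) x" "(f ^^ n) x \<le> y" if "j \<le> n" for n
        using that True xup up[of "(f ^^ j) x" "n - j"] split[OF that]
        by (simp_all add: dir fix_le)
      have "\<bar>(f ^^ n) x - y\<bar> < \<delta>" if "j \<le> n" for n
        using between[OF that] near by linarith
      then show ?thesis by blast
    next
      case False
      have "\<bar>w - y\<bar> < \<delta>" if w: "(f ^^ n) w = x" for n w
      proof -
        have "y \<le> w" using False fix_le[of n w] w by simp
        moreover have "w \<le> x" using up[of w n] dir(1)[of n w] xup w by simp
        moreover have "x \<le> (f ^^ j) x" using up xup by simp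
        ultimately show ?thesis using near by linarith
      qed
      then show ?thesis by blast
    qed
  next
    case False
    then have xdown: "f x \<le> x" by simp
    show ?thesis
    proof (cases "y \<le> x")
      case True
      have between: "(f ^^ n) x \<le> (f ^^ j) x" "y \<le> (f ^^ n) x" if "j \<le> n" for n
        using that True xdown down[of "(f ^^ j) x" "n - j"] split[OF that]
        by (simp_all add: dir fix_le)
      have "\<bar>(f ^^ n) x - y\<bar> < \<delta>" if "j \<le> n" for n
        using between[OF that] near by linarith
      then show ?thesis by blast
    next
      case False
      have "\<bar>w - y\<bar> < \<delta>" if w: "(f ^^ n) w = x" for n w
      proof -
        have "w \<le> y" using False fix_le[of n w] w by simp
        moreover have "x \<le> w" using down[of w n] dir(2)[of n w] xdown w by simp
        moreover have "(f ^^ j) x \<le> x" using down xdown by simp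
        ultimately show ?thesis using near by linarith
      qed
      then show ?thesis by blast
    qed
  qed
qed

section \<open>Metric comparisons on the circle\<close>

text \<open>
  This is continuity of the argument at \<open>1\<close>: dividing by a unimodular \<open>v\<close> turns the distance of
  \<open>u\<close> and \<open>v\<close> into that of \<open>u / v\<close> and \<open>1\<close>. It lets uniform continuity be used in the
  Euclidean metric.
\<close>
lemma arc_dist_small_if_dist_small:
  assumes "\<epsilon> > 0"
  obtains \<eta> where "\<eta> > 0"
    "\<And>u v. \<lbrakk>u \<in> circle; v \<in> circle; dist u v < \<eta>\<rbrakk> \<Longrightarrow> arc_dist u v < \<epsilon>"
proof -
  have "isCont Arg 1" by (intro continuous_at_Arg) simp
  then obtain \<eta> where \<eta>: "\<eta> > 0" "\<And>w. dist w 1 < \<eta> \<Longrightarrow> dist (Arg w) (Arg 1) < \<epsilon>"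
    using assms unfolding continuous_at_eps_delta by blast
  have "arc_dist u v < \<epsilon>" if "u \<in> circle" "v \<in> circle" "dist u v < \<eta>" for u v
  proof -
    have "v \<noteq> 0" "norm v = 1" using that by auto
    then have "dist (u / v) 1 = dist u v"
      by (simp add: dist_norm divide_simps flip: norm_divide)
         (simp add: norm_divide diff_divide_distrib[symmetric])
    then show ?thesis using \<eta>(2)[of "u / v"] that by (simp add: arc_dist_def)
  qed
  with \<eta>(1) show thesis by (rule that)
qed

lemma continuous_on_funpow:
  assumes "continuous_on S f" "f ` S \<subseteq> S"
  shows "continuous_on S (f ^^ n) \<and> (f ^^ n) ` S \<subseteq> S"
proof (induction n)
  case (Suc n)
  then show ?case
    using assms continuous_on_compose[of S "f ^^ n" f]
    by (auto intro: continuous_on_subset)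
qed simp

lemma iterates_equicontinuous_on_circle:
  fixes q :: nat
  assumes g: "continuous_on circle g" "g ` circle \<subseteq> circle" and "\<epsilon> > 0"
  obtains \<eta> where "\<eta> > 0"
    "\<And>u v i. \<lbrakk>u \<in> circle; v \<in> circle; dist u v < \<eta>; i < q\<rbrakk>
       \<Longrightarrow> arc_dist ((g ^^ i) u) ((g ^^ i) v) < \<epsilon>"
proof -
  obtain \<beta> where \<beta>: "\<beta> > 0"
    "\<And>u v. \<lbrakk>u \<in> circle; v \<in> circle; dist u v < \<beta>\<rbrakk> \<Longrightarrow> arc_dist u v < \<epsilon>"
    using arc_dist_small_if_dist_small[OF \<open>\<epsilon> > 0\<close>] by blast
  have "\<exists>\<eta>>0. \<forall>u\<in>circle. \<forall>v\<in>circle. dist u v < \<eta> \<longrightarrow>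
      (\<forall>i<q. arc_dist ((g ^^ i) u) ((g ^^ i) v) < \<epsilon>)"
  proof (induction q)
    case 0
    then show ?case by (auto intro: exI[of _ 1])
  next
    case (Suc q)
    then obtain \<eta> where \<eta>: "\<eta> > 0" "\<forall>u\<in>circle. \<forall>v\<in>circle. dist u v < \<eta> \<longrightarrow>
      (\<forall>i<q. arc_dist ((g ^^ i) u) ((g ^^ i) v) < \<epsilon>)" by blast
    have cq: "continuous_on circle (g ^^ q)" and im: "(g ^^ q) ` circle \<subseteq> circle"
      using continuous_on_funpow[OF g, of q] by auto
    have "uniformly_continuous_on circle (g ^^ q)"
      using cq by (rule compact_uniformly_continuous) simp
    then obtain \<gamma> where \<gamma>: "\<gamma> > 0"
      "\<And>u v. \<lbrakk>u \<in> circle; v \<in> circle; dist u v < \<gamma>\<rbrakk> \<Longrightarrow> dist ((g ^^ q) u) ((g ^^ q) v) < \<beta>"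
      using \<open>\<beta> > 0\<close> unfolding uniformly_continuous_on_def by (metis dist_commute)
    have "arc_dist ((g ^^ q) u) ((g ^^ q) v) < \<epsilon>"
      if "u \<in> circle" "v \<in> circle" "dist u v < \<gamma>" for u v
      using that im by (intro \<beta>(2) \<gamma>(2)) blast+
    then show ?case
      using \<eta> \<gamma>(1) by (intro exI[of _ "min \<eta> \<gamma>"]) (simp only: less_Suc_eq min_less_iff_conj; blast)
  qed
  then show thesis using that by blast
qed

lemma dist_circle_point_le: "dist (circle_point s) (circle_point t) \<le> 2 * pi * \<bar>s - t\<bar>"
proof -
  have "circle_point s - circle_point t =
      circle_point t * (exp (\<i> * of_real (2 * pi * (s - t))) - 1)"
    by (simp add: circle_point_def algebra_simps flip: exp_add)
  then have "dist (circle_point s) (circle_point t) = 2 * \<bar>sin (pi * (s - t))\<bar>"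
    using circle_point_in_circle[of t]
    by (simp add: dist_norm norm_mult dist_exp_i_1 del: of_real_mult of_real_diff)
  also have "\<dots> \<le> 2 * \<bar>pi * (s - t)\<bar>"
    using abs_sin_x_le_abs_x by simp
  finally show ?thesis by (simp add: abs_mult)
qed

section \<open>Uniform shadowing by periodic orbits\<close>

theorem theorem2p9:
  fixes \<phi> \<phi>_inv :: "complex \<Rightarrow> complex" and p :: int and q :: nat
  assumes "homeomorphism circle circle \<phi> \<phi>_inv"
    and "orientation_preserving \<phi>"
    and "q > 0"
    and "rotation_number \<phi> = frac (real_of_int p / real q)"
  shows "\<forall>\<epsilon>>0. \<exists>N::nat. \<forall>z\<in>circle.
           (\<exists>z\<^sub>0\<in>Per \<phi>. \<forall>n\<ge>N. \<forall>i<q.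
              arc_dist ((\<phi> ^^ (n * q + i)) z) ((\<phi> ^^ i) z\<^sub>0) < \<epsilon>) \<or>
           (\<exists>z\<^sub>0\<in>Per \<phi>. \<forall>n\<ge>N. \<forall>i<q.
              arc_dist ((\<phi>_inv ^^ (n * q + i)) z) ((\<phi>_inv ^^ i) z\<^sub>0) < \<epsilon>)"
proof (intro allI impI)
  fix \<epsilon> :: real assume "\<epsilon> > 0"
  have cont: "continuous_on circle \<phi>" "continuous_on circle \<phi>_inv"
    and im: "\<phi> ` circle \<subseteq> circle" "\<phi>_inv ` circle \<subseteq> circle"
    and inv1: "\<And>z. z \<in> circle \<Longrightarrow> \<phi>_inv (\<phi> z) = z"
    and inv2: "\<And>z. z \<in> circle \<Longrightarrow> \<phi> (\<phi>_inv z) = z"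
    using assms(1) unfolding homeomorphism_def by blast+
  have inj: "inj_on \<phi> circle" by (rule inj_on_inverseI[where g = \<phi>_inv]) (rule inv1)
  obtain \<Phi> where lift: "circle_lift \<phi> \<Phi>" and "strict_mono \<Phi>"
    using assms(2) unfolding orientation_preserving_def by blast
  then have \<Phi>: "lift_map \<Phi>"
    using lift_map_if_strict_mono_circle_lift inj by blast
  have comm: "(\<phi> ^^ n) (circle_point x) = circle_point ((\<Phi> ^^ n) x)" for n x
    using lift by (induction n) (auto simp: circle_lift_iff)

  obtain L where L: "\<And>n x. \<bar>(\<Phi> ^^ n) x - x - real n * L\<bar> \<le> 2"
    using translation_number_exists[OF \<Phi>] by blast
  have "frac L = frac (real_of_int p / real q)"
    using rotation_number_eq_frac_translation_number[OF lift \<Phi> L] assms(4) by simp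
  then obtain m :: int where m: "L = real_of_int p / real q + of_int m"
    by (rule frac_eqE)
  define k where "k = p + int q * m"
  have k: "real q * L = of_int k"
    using \<open>q > 0\<close> by (simp add: m k_def field_simps)
  \<comment> \<open>The lift \<open>\<Psi>\<close> of \<open>\<phi>\<^sup>q\<close> with translation number \<open>0\<close>; its orbits are bounded.\<close>
  define \<Psi> where "\<Psi> x = (\<Phi> ^^ q) x - of_int k" for x
  have \<Psi>: "lift_map \<Psi>"
    unfolding \<Psi>_def by (intro lift_map_minus_int lift_map_funpow \<Phi>)
  have \<Psi>_iter: "(\<Psi> ^^ n) x = (\<Phi> ^^ (n * q)) x - real n * of_int k" for n x
  proof (induction n)
    case (Suc n)
    have "(\<Psi> ^^ Suc n) x = (\<Phi> ^^ q) ((\<Phi> ^^ (n * q)) x + of_int (- int n * k)) - of_int k"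
      using Suc \<Psi>_def[of "(\<Psi> ^^ n) x"] by simp
    also have "\<dots> = (\<Phi> ^^ (Suc n * q)) x - real (Suc n) * of_int k"
      by (subst lift_map_add_int[OF lift_map_funpow[OF \<Phi>]]) (simp add: funpow_add algebra_simps)
    finally show ?case .
  qed simp
  have bdd: "\<bar>(\<Psi> ^^ n) x - x\<bar> \<le> 2" for n x
  proof -
    have nq: "real (n * q) * L = real n * of_int k" using k by simp
    show ?thesis using L[of "n * q" x] unfolding \<Psi>_iter nq by linarith
  qed
  have comm\<Psi>: "(\<phi> ^^ (n * q)) (circle_point x) = circle_point ((\<Psi> ^^ n) x)" for n x
    unfolding comm \<Psi>_iter circle_point_eq_iff
    by (rule exI[of _ "int n * k"]) simp

  obtain \<eta>1 where \<eta>1: "\<eta>1 > 0" "\<And>u v i. \<lbrakk>u \<in> circle; v \<in> circle; dist u v < \<eta>1; i < q\<rbrakk>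
       \<Longrightarrow> arc_dist ((\<phi> ^^ i) u) ((\<phi> ^^ i) v) < \<epsilon>"
    by (rule iterates_equicontinuous_on_circle[OF cont(1) im(1) \<open>\<epsilon> > 0\<close>, of q]) (rule that)
  obtain \<eta>2 where \<eta>2: "\<eta>2 > 0" "\<And>u v i. \<lbrakk>u \<in> circle; v \<in> circle; dist u v < \<eta>2; i < q\<rbrakk>
       \<Longrightarrow> arc_dist ((\<phi>_inv ^^ i) u) ((\<phi>_inv ^^ i) v) < \<epsilon>"
    by (rule iterates_equicontinuous_on_circle[OF cont(2) im(2) \<open>\<epsilon> > 0\<close>, of q]) (rule that)
  \<comment> \<open>The factor \<open>2 * pi\<close> is the Lipschitz constant of \<open>circle_point\<close>.\<close>
  define \<delta> where "\<delta> = min \<eta>1 \<eta>2 / (2 * pi)"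
  have "\<delta> > 0" using \<eta>1 \<eta>2 by (simp add: \<delta>_def)
  have close: "dist (circle_point s) (circle_point t) < \<eta>1"
    "dist (circle_point s) (circle_point t) < \<eta>2" if "\<bar>s - t\<bar> < \<delta>" for s t
  proof -
    have "2 * pi * \<bar>s - t\<bar> < min \<eta>1 \<eta>2"
      using that by (simp add: \<delta>_def field_simps)
    then show "dist (circle_point s) (circle_point t) < \<eta>1"
      "dist (circle_point s) (circle_point t) < \<eta>2"
      using dist_circle_point_le[of s t] by simp_all
  qed
  obtain N where N: "\<And>x. \<exists>j\<le>N. \<exists>y. \<Psi> y = y \<and> \<bar>(\<Psi> ^^ j) x - y\<bar> < \<delta>"
    using orbits_reach_fixed_points_in_bounded_time[OF \<Psi> bdd \<open>\<delta> > 0\<close>] by blast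
  have per: "circle_point y \<in> Per \<phi>" if "\<Psi> y = y" for y
    using comm\<Psi>[of 1 y] that \<open>q > 0\<close> circle_point_in_circle by (auto simp: Per_def)
  have inv_in: "(\<phi>_inv ^^ n) z \<in> circle" if "z \<in> circle" for n z
    using continuous_on_funpow[OF cont(2) im(2), of n] that by blast
  have inv_funpow: "(\<phi> ^^ n) ((\<phi>_inv ^^ n) z) = z" if "z \<in> circle" for n z
  proof (induction n)
    case (Suc n)
    have "(\<phi> ^^ Suc n) ((\<phi>_inv ^^ Suc n) z) = (\<phi> ^^ n) (\<phi> (\<phi>_inv ((\<phi>_inv ^^ n) z)))"
      by (simp add: funpow_swap1)
    also have "\<phi> (\<phi>_inv ((\<phi>_inv ^^ n) z)) = (\<phi>_inv ^^ n) z"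
      by (rule inv2[OF inv_in[OF that]])
    finally show ?case using Suc by simp
  qed simp
  \<comment> \<open>A backward iterate lifts to a preimage under \<open>\<Psi>\<^sup>n\<close> of \<open>x\<close> modulo \<open>1\<close>; an integer translation
    makes it a preimage of \<open>x\<close> itself.\<close>
  have backward: "\<exists>w. (\<phi>_inv ^^ (n * q)) (circle_point x) = circle_point w \<and> (\<Psi> ^^ n) w = x" for n x
  proof -
    obtain v where v: "(\<phi>_inv ^^ (n * q)) (circle_point x) = circle_point v"
      using circle_point_surj inv_in circle_point_in_circle by metis
    have "circle_point x = circle_point ((\<Psi> ^^ n) v)"
      using inv_funpow[OF circle_point_in_circle, of "n * q" x] by (simp add: v comm\<Psi>)
    then obtain l :: int where l: "x = (\<Psi> ^^ n) v + of_int l"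
      unfolding circle_point_eq_iff by blast
    have "(\<Psi> ^^ n) (v + of_int l) = x"
      using l by (simp add: lift_map_add_int[OF lift_map_funpow[OF \<Psi>]])
    moreover have "circle_point v = circle_point (v + of_int l)"
      unfolding circle_point_eq_iff by (rule exI[of _ "- l"]) simp
    ultimately show ?thesis using v by metis
  qed
  show "\<exists>N::nat. \<forall>z\<in>circle.
           (\<exists>z\<^sub>0\<in>Per \<phi>. \<forall>n\<ge>N. \<forall>i<q.
              arc_dist ((\<phi> ^^ (n * q + i)) z) ((\<phi> ^^ i) z\<^sub>0) < \<epsilon>) \<or>
           (\<exists>z\<^sub>0\<in>Per \<phi>. \<forall>n\<ge>N. \<forall>i<q.
              arc_dist ((\<phi>_inv ^^ (n * q + i)) z) ((\<phi>_inv ^^ i) z\<^sub>0) < \<epsilon>)"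
  proof (intro exI[of _ N] ballI)
    fix z :: complex assume "z \<in> circle"
    then obtain x where x: "z = circle_point x" by (rule circle_point_surj)
    obtain j y where j: "j \<le> N" and y: "\<Psi> y = y" "\<bar>(\<Psi> ^^ j) x - y\<bar> < \<delta>"
      using N by blast
    have shift: "(g ^^ (n * q + i)) z = (g ^^ i) ((g ^^ (n * q)) z)" for g :: "complex \<Rightarrow> complex" and n i
      by (simp add: funpow_add add.commute)
    consider "\<forall>n\<ge>j. \<bar>(\<Psi> ^^ n) x - y\<bar> < \<delta>" | "\<forall>n w. (\<Psi> ^^ n) w = x \<longrightarrow> \<bar>w - y\<bar> < \<delta>"
      using shadowing_of_orbit_near_fixed_point[OF \<Psi> y] by blast
    then show "(\<exists>z\<^sub>0\<in>Per \<phi>. \<forall>n\<ge>N. \<forall>i<q.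
              arc_dist ((\<phi> ^^ (n * q + i)) z) ((\<phi> ^^ i) z\<^sub>0) < \<epsilon>) \<or>
           (\<exists>z\<^sub>0\<in>Per \<phi>. \<forall>n\<ge>N. \<forall>i<q.
              arc_dist ((\<phi>_inv ^^ (n * q + i)) z) ((\<phi>_inv ^^ i) z\<^sub>0) < \<epsilon>)"
    proof cases
      case 1
      have "arc_dist ((\<phi> ^^ (n * q + i)) z) ((\<phi> ^^ i) (circle_point y)) < \<epsilon>"
        if "n \<ge> N" "i < q" for n i
      proof -
        have "\<bar>(\<Psi> ^^ n) x - y\<bar> < \<delta>" using 1 j that by simp
        then show ?thesis
          unfolding shift unfolding x comm\<Psi>
          using that close(1) by (intro \<eta>1(2) circle_point_in_circle)
      qed
      then show ?thesis using per[OF y(1)] by blast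
    next
      case 2
      have "arc_dist ((\<phi>_inv ^^ (n * q + i)) z) ((\<phi>_inv ^^ i) (circle_point y)) < \<epsilon>"
        if "i < q" for n i
      proof -
        obtain w where w: "(\<phi>_inv ^^ (n * q)) z = circle_point w" "(\<Psi> ^^ n) w = x"
          using backward x by blast
        then have "\<bar>w - y\<bar> < \<delta>" using 2 by blast
        then show ?thesis
          unfolding shift w(1)
          using that close(2) by (intro \<eta>2(2) circle_point_in_circle)
      qed
      then show ?thesis using per[OF y(1)] by blast
    qed
  qed
qed

end
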